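(* Let $T$ be a tree, let $c$ be a labeling of $T$, let $S=S_c(T)$ be the set of consistent vertices under $c$, and assume $|S|\ge 2$. Let $a,b\in S$ be the vertices with $c(a)=\min\{c(x):x\in S\}$ and $c(b)=\max\{c(x):x\in S\}$, and let $P_{ab}=p_1p_2\cdots p_m$ be the unique $a$--$b$ path in $T$, with $p_1=a$, $p_m=b$. Let $t$ be an integer with $1\le t\le m-2$. Then $$N^{t}[a]\subseteq\{p_1,\dots,p_{t+1}\}\cup c^{-1}\bigl([c(a)-t-1,\,c(a)-1]\bigr),$$ and consequently $|N^{t}[a]|\le 2t+2$. Symmetrically, $$N^{t}[b]\subseteq\{p_m,p_{m-1},\dots,p_{m-t}\}\cup c^{-1}\bigl([c(b)+1,\,c(b)+t+1]\bigr),$$ and $|N^{t}[b]|\le 2t+2$.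
   Context: All graphs are finite, simple and connected; $d(u,v)$ denotes graph distance. For a graph $G$ on $n$ vertices, a labeling is a bijection $c:V(G)\to\{1,\dots,n\}$; write $c(u,v)=|c(u)-c(v)|$. A vertex $u$ is (list-distance) consistent under $c$ if for all $v,w\in V(G)$, $d(u,v)<d(u,w)$ implies $c(u,v)\le c(u,w)$. $S_c(G)$ denotes the set of consistent vertices under $c$. $N^{t}[u]=\{x\in V(G):d(u,x)\le t\}$ is the closed ball of radius $t$ about $u$. $[i,j]=\{i,i+1,\dots,j\}$ is an integer interval, and $c^{-1}(I)$ is the set of vertices whose label lies in $I$ (elements of $I$ outside $\{1,\dots,n\}$ contribute nothing). *)

theory Defs
  imports "Graph_Theory.Graph_Theory"
begin

text \<open>
  A finite simple graph is \<^locale>\<open>graph\<close>, i.e. a finite, loop-free, symmetric digraph without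
  parallel arcs: each undirected edge is a pair of opposite arcs.  The predicate
  \<^const>\<open>Digraph_Component.tree\<close> is of no use here, because it counts the closed walk \<open>u, v, u\<close>
  along a single edge as a cycle; the cycles of the undirected graph are the directed ones
  of length at least 3.
\<close>

definition undirected_tree :: "('a, 'b) pre_digraph \<Rightarrow> bool" where
  "undirected_tree G \<longleftrightarrow>
     Digraph.graph G \<and> Digraph_Component.connected G \<and>
     \<not> (\<exists>p. pre_digraph.cycle G p \<and> 3 \<le> length p)"

text \<open>Meaningful only if \<open>v\<close> is reachable from \<open>u\<close>: the infimum of the empty set is 0 in
  \<^typ>\<open>nat\<close>.\<close>

definition gdist :: "('a, 'b) pre_digraph \<Rightarrow> 'a \<Rightarrow> 'a \<Rightarrow> nat" where
  "gdist G u v = (INF p \<in> {p. pre_digraph.awalk G u p v}. length p)"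

lemma (in wf_digraph) ereal_gdist:
  assumes "u \<rightarrow>\<^sup>* v"
  shows "ereal (real (gdist G u v)) = \<mu> (\<lambda>_. 1) u v"
proof -
  let ?L = "length ` {p. awalk u p v}"
  have ne: "?L \<noteq> {}" using assms by (auto simp: reachable_awalk)
  then have "Inf ?L \<in> ?L" by (rule Inf_nat_def1)
  then obtain q where q: "awalk u q v" "length q = gdist G u v"
    by (auto simp: gdist_def)
  have cost: "awalk_cost (\<lambda>_. 1) p = real (length p)" for p :: "'b list"
    by (induct p) auto
  have le: "gdist G u v \<le> length p" if "awalk u p v" for p
    unfolding gdist_def using that by (intro cInf_lower) auto
  show ?thesis
  proof (rule antisym)
    show "ereal (real (gdist G u v)) \<le> \<mu> (\<lambda>_. 1) u v"
      unfolding \<mu>_def by (rule INF_greatest) (use le in \<open>auto simp: cost\<close>)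
    show "\<mu> (\<lambda>_. 1) u v \<le> ereal (real (gdist G u v))"
      using min_cost_le_walk_cost[OF q(1), of "\<lambda>_. 1"] q(2) by (simp add: cost)
  qed
qed

definition closed_nbhd :: "('a, 'b) pre_digraph \<Rightarrow> nat \<Rightarrow> 'a \<Rightarrow> 'a set" where
  "closed_nbhd G t u = {x \<in> verts G. gdist G u x \<le> t}"

text \<open>Labels are integers, so that intervals such as \<open>{c a - t - 1..c a - 1}\<close> may extend
  below 1.\<close>

definition labeling :: "('a, 'b) pre_digraph \<Rightarrow> ('a \<Rightarrow> int) \<Rightarrow> bool" where
  "labeling G c \<longleftrightarrow> bij_betw c (verts G) {1..int (card (verts G))}"

definition label_dist :: "('a \<Rightarrow> int) \<Rightarrow> 'a \<Rightarrow> 'a \<Rightarrow> int" where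
  "label_dist c u v = \<bar>c u - c v\<bar>"

definition consistent :: "('a, 'b) pre_digraph \<Rightarrow> ('a \<Rightarrow> int) \<Rightarrow> 'a \<Rightarrow> bool" where
  "consistent G c u \<longleftrightarrow>
     (\<forall>v \<in> verts G. \<forall>w \<in> verts G.
        gdist G u v < gdist G u w \<longrightarrow> label_dist c u v \<le> label_dist c u w)"

definition consistent_verts :: "('a, 'b) pre_digraph \<Rightarrow> ('a \<Rightarrow> int) \<Rightarrow> 'a set" where
  "consistent_verts G c = {u \<in> verts G. consistent G c u}"

definition label_preimage :: "('a, 'b) pre_digraph \<Rightarrow> ('a \<Rightarrow> int) \<Rightarrow> int set \<Rightarrow> 'a set" where
  "label_preimage G c I = {x \<in> verts G. c x \<in> I}"

end

theory Submission
  imports Defs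
begin

text \<open>
  A vertex \<open>x\<close> off the path hangs from some path vertex \<open>v\<close> that is nearer to both \<open>a\<close> and \<open>b\<close>;
  were \<open>c x\<close> between \<open>c a\<close> and \<open>c b\<close>, consistency of \<open>a\<close> and \<open>b\<close> would give \<open>c v \<le> c x\<close> and
  \<open>c x \<le> c v\<close>.  Hence the labels in \<open>[c a, c b]\<close> are exactly those of the path, in consecutive
  order.  So the path vertex at distance \<open>t + 1\<close> from \<open>a\<close> has label \<open>c a + t + 1\<close>, and consistency
  of \<open>a\<close> keeps the labels of its \<open>t\<close>-ball within \<open>t + 1\<close> of \<open>c a\<close>.  The claim at \<open>b\<close> is the claim
  at \<open>a\<close> for the reversed path and the labels \<open>- c\<close>.
\<close>

section \<open>Vertex walks, arc walks and distance\<close>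

text \<open>\<open>gdist\<close> minimises over lists of arcs, whereas paths here are lists of
  vertices; choosing an arc for each consecutive pair translates the latter into the former.\<close>

lemma (in wf_digraph) vwalk_imp_awalk:
  assumes "vwalk p G"
  shows "\<exists>q. awalk (hd p) q (last p) \<and> awalk_verts (hd p) q = p"
  using assms
proof (induct p rule: vwalk_induct)
  case (Base u)
  then show ?case by (intro exI[of _ "[]"]) (simp add: awalk_Nil_iff)
next
  case (Cons u v es)
  then obtain q where q: "awalk v q (last (v # es))" "awalk_verts v q = v # es" by auto
  from Cons(1) obtain e where e: "e \<in> arcs G" "tail G e = u" "head G e = v"
    by (auto simp: arcs_ends_conv)
  from q e have "awalk u (e # q) (last (v # es)) \<and> awalk_verts u (e # q) = u # v # es"
    by (simp add: awalk_Cons_iff)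
  then show ?case by (intro exI[of _ "e # q"]) simp
qed

lemma (in wf_digraph) gdist_le_vwalk:
  assumes "vwalk p G"
  shows "gdist G (hd p) (last p) \<le> length p - 1"
proof -
  obtain q where q: "awalk (hd p) q (last p)" "awalk_verts (hd p) q = p"
    using vwalk_imp_awalk[OF assms] by blast
  have "gdist G (hd p) (last p) \<le> length q"
    unfolding gdist_def using q(1) by (intro cInf_lower) auto
  also have "length q = length p - 1"
    using length_awalk_verts[of "hd p" q] q(2) by simp
  finally show ?thesis .
qed

text \<open>Reachability makes the infimum in \<open>gdist\<close> attained. Cutting the loops out
  of a shortest walk cannot lengthen it, and the distance bounds the result from below, so the
  length is kept.\<close>

lemma (in wf_digraph) ex_shortest_vpath:
  assumes "u \<rightarrow>\<^sup>* v"
  obtains p where "vpath p G" "hd p = u" "last p = v" "length p = Suc (gdist G u v)"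
proof -
  have "length ` {p. awalk u p v} \<noteq> {}" using assms by (auto simp: reachable_awalk)
  then have "gdist G u v \<in> length ` {p. awalk u p v}"
    unfolding gdist_def by (rule Inf_nat_def1)
  then obtain q where q: "awalk u q v" "length q = gdist G u v" by auto
  define w where "w = awalk_verts u q"
  have w: "vwalk w G" "hd w = u" "last w = v" "length w = Suc (gdist G u v)"
    using q awalk_imp_vwalk[OF q(1)] by (auto simp: w_def length_awalk_verts)
  have len: "length (vwalk_to_vpath xs) \<le> length xs" for xs :: "'a list"
  proof (induct xs rule: vwalk_to_vpath_induct3)
    case (in_set x xs)
    then show ?case using length_dropWhile_le[of "\<lambda>y. y \<noteq> x" xs] by simp
  qed auto
  define p where "p = vwalk_to_vpath w"
  have p: "vpath p G" "hd p = u" "last p = v" "length p \<le> Suc (gdist G u v)"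
    using w len[of w]
    by (auto simp: p_def vwalk_to_vpath_hd vwalk_to_vpath_last vwalk_to_vpath_vpath)
  moreover have "gdist G u v \<le> length p - 1"
    using gdist_le_vwalk[of p] p by auto
  moreover have "p \<noteq> []" using p(1) by auto
  ultimately have "length p = Suc (gdist G u v)" by (cases p) auto
  with p show thesis by (intro that)
qed

section \<open>Unique paths and distances in trees\<close>

lemma undirected_tree_graph: "undirected_tree G \<Longrightarrow> graph G"
  by (simp add: undirected_tree_def)

lemma undirected_tree_reachable:
  assumes "undirected_tree G" "u \<in> verts G" "v \<in> verts G"
  shows "u \<rightarrow>\<^sup>*\<^bsub>G\<^esub> v"
proof -
  interpret graph G using assms(1) by (rule undirected_tree_graph)
  have "sym (arcs_ends G)" using sym_arcs by (simp add: symmetric_def)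
  \<comment> \<open>Connectedness speaks of the symmetric closure, which adds nothing to a symmetric
    digraph.\<close>
  then have "(arcs_ends G)\<^sup>s = arcs_ends G" by (auto simp: symcl_def sym_def)
  then show ?thesis
    using assms by (auto simp: undirected_tree_def connected_conv reachable_def)
qed

text \<open>An arc from the last vertex back to the first would close \<open>p\<close> to a cycle
  with as many arcs as \<open>p\<close> has vertices.\<close>

lemma undirected_tree_no_chord:
  assumes tree: "undirected_tree G" and p: "vpath p G" "3 \<le> length p"
  shows "(last p, hd p) \<notin> arcs_ends G"
proof
  interpret graph G using tree by (rule undirected_tree_graph)
  assume "(last p, hd p) \<in> arcs_ends G"
  then obtain e where e: "e \<in> arcs G" "tail G e = last p" "head G e = hd p"
    by (auto simp: arcs_ends_conv)
  obtain q where q: "awalk (hd p) q (last p)" "awalk_verts (hd p) q = p"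
    using vwalk_imp_awalk p by blast
  have len: "length q = length p - 1"
    using length_awalk_verts[of "hd p" q] q(2) by simp
  have w: "awalk (last p) (e # q) (last p)"
    using q e by (simp add: awalk_Cons_iff)
  \<comment> \<open>\<open>cycle\<close> asks for distinct vertices after the first entry of this
    list, and those form \<open>p\<close> itself.\<close>
  have "awalk_verts (last p) (e # q) = last p # p" using e q by simp
  then have "cycle (e # q)"
    unfolding cycle_def using w p(1) by (intro exI[of _ "last p"]) auto
  moreover have "3 \<le> length (e # q)" using len p(2) by simp
  ultimately show False using tree by (auto simp: undirected_tree_def)
qed

text \<open>Induction along the first path: once the second vertices agree, the tails are again
  paths with common ends.\<close>

lemma undirected_tree_vpath_unique:
  assumes tree: "undirected_tree G"
    and "vpath p G" "vpath q G" "hd p = hd q" "last p = last q"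
  shows "p = q"
  using assms(2-)
proof (induct p arbitrary: q)
  case Nil
  then show ?case by auto
next
  case (Cons u p')
  interpret graph G using tree by (rule undirected_tree_graph)
  from Cons.prems obtain q' where q: "q = u # q'" by (cases q) auto
  show ?case
  proof (cases "p' = [] \<or> q' = []")
    \<comment> \<open>One path is the single vertex \<open>u\<close>; the other then starts and ends
      at \<open>u\<close>, so distinctness makes it trivial too.\<close>
    case True
    then show ?thesis using Cons.prems q
      by (auto split: if_splits)
  next
    case False
    have up: "(u, hd p') \<in> arcs_ends G" "vwalk p' G" "u \<notin> set p'" "distinct p'"
      using Cons.prems(1) False by (auto elim!: vwalk_consE)
    have uq: "(u, hd q') \<in> arcs_ends G" "vwalk q' G" "u \<notin> set q'" "distinct q'"
      using Cons.prems(2) False q by (auto elim!: vwalk_consE)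
    have last: "last p' = last q'" using Cons.prems(4) False q by simp
    \<comment> \<open>Otherwise the two tails join to a path from \<open>hd p'\<close> to \<open>hd q'\<close> avoiding \<open>u\<close>; prefixed by \<open>u\<close> it has a chord.\<close>
    have "hd p' = hd q'"
    proof (rule ccontr)
      assume neq: "hd p' \<noteq> hd q'"
      have rq: "vwalk (rev q') G" using uq(2) sym_arcs by (intro vwalk_rev_ex)
      define r where "r = concat_vpath p' (rev q')"
      have r: "vpath r G" "hd r = hd p'" "last r = hd q'"
        using concat_vpath_is_vpath[OF up(2) refl last rq _ refl] False
        by (auto simp: r_def hd_rev last_rev)
      have "set r \<subseteq> set p' \<union> set q'"
      proof
        fix z assume "z \<in> set r"
        then have "z \<in> set (p' \<oplus> rev q')"
          unfolding r_def concat_vpath_def by (rule vwalk_to_vpath_subset)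
        then show "z \<in> set p' \<union> set q'"
          unfolding vwalk_join_def using list.set_sel(2)[of "rev q'" z] False by auto
      qed
      then have "u \<notin> set r" using up uq by auto
      moreover have rne: "r \<noteq> []" using r(1) by auto
      moreover have "vwalk (u # r) G"
        using r up(1) by (intro vwalk_wf_digraph_consI) auto
      ultimately have "vpath (u # r) G" using r(1) by (simp add: vpath_def)
      \<comment> \<open>The ends of \<open>r\<close> differ, so \<open>r\<close> has at least two
        vertices besides \<open>u\<close>.\<close>
      moreover have "3 \<le> length (u # r)"
      proof -
        obtain y r' where "r = y # r'" using rne by (cases r) auto
        moreover have "r' \<noteq> []" using neq r calculation by auto
        ultimately show ?thesis by (cases r') auto
      qed
      ultimately have "(last (u # r), hd (u # r)) \<notin> arcs_ends G"
        by (rule undirected_tree_no_chord[OF tree])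
      moreover have "(hd q', u) \<in> arcs_ends G"
        using uq(1) sym_arcs arcs_ends_symmetric by metis
      ultimately show False using r(3) rne by simp
    qed
    then have "p' = q'" using up uq last by (intro Cons.hyps) auto
    then show ?thesis using q by simp
  qed
qed

text \<open>By uniqueness every path is the shortest one between its ends.\<close>

lemma undirected_tree_gdist_vpath:
  assumes tree: "undirected_tree G" and p: "vpath p G"
  shows "gdist G (hd p) (last p) = length p - 1"
proof -
  interpret graph G using tree by (rule undirected_tree_graph)
  have "hd p \<rightarrow>\<^sup>*\<^bsub>G\<^esub> last p" using p reachable_vpath_conv by blast
  then obtain q where q: "vpath q G" "hd q = hd p" "last q = last p"
      "length q = Suc (gdist G (hd p) (last p))"
    by (rule ex_shortest_vpath)
  then have "q = p" using undirected_tree_vpath_unique[OF tree q(1) p] by simp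
  then show ?thesis using q(4) by simp
qed

lemma vpath_take:
  assumes "vpath p G" "0 < n"
  shows "vpath (take n p) G"
proof -
  have "p \<noteq> []" using assms by auto
  then show ?thesis
    using vwalkI_append_l[of "take n p" "drop n p" G] assms by (auto simp: vpath_def)
qed

lemma (in sym_digraph) vpath_rev: "vpath p G \<Longrightarrow> vpath (rev p) G"
  using vwalk_rev_ex sym_arcs by (auto simp: vpath_def)

lemma undirected_tree_gdist_nth:
  assumes tree: "undirected_tree G" and p: "vpath p G" and i: "i < length p"
  shows "gdist G (hd p) (p ! i) = i"
proof -
  have "vpath (take (Suc i) p) G" using p by (rule vpath_take) simp
  from undirected_tree_gdist_vpath[OF tree this] show ?thesis
    using i by (simp add: take_Suc_conv_app_nth hd_append) (auto simp: hd_conv_nth split: if_splits)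
qed

lemma undirected_tree_gdist_nth_last:
  assumes tree: "undirected_tree G" and p: "vpath p G" and i: "i < length p"
  shows "gdist G (last p) (p ! i) = length p - Suc i"
proof -
  interpret graph G using tree by (rule undirected_tree_graph)
  have "gdist G (hd (rev p)) (rev p ! (length p - Suc i)) = length p - Suc i"
    using i by (intro undirected_tree_gdist_nth[OF tree vpath_rev[OF p]]) simp
  then show ?thesis using i by (simp add: hd_rev rev_nth Suc_diff_Suc)
qed

text \<open>The paths to \<open>x\<close> from both ends of \<open>p\<close> leave \<open>p\<close>
  at the same vertex \<open>v\<close>, and at least one further arc leads from there to
  \<open>x\<close>.\<close>

lemma undirected_tree_gate:
  assumes tree: "undirected_tree G" and p: "vpath p G"
    and x: "x \<in> verts G" "x \<notin> set p"
  obtains v where "v \<in> set p"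
    "gdist G (hd p) v < gdist G (hd p) x" "gdist G (last p) v < gdist G (last p) x"
proof -
  interpret graph G using tree by (rule undirected_tree_graph)
  have pne: "p \<noteq> []" and pv: "set p \<subseteq> verts G" using p by auto
  \<comment> \<open>Take \<open>v\<close> nearest to \<open>x\<close>: a shortest path from \<open>v\<close> to \<open>x\<close> then meets \<open>p\<close> only in \<open>v\<close>.\<close>
  obtain v where v: "v \<in> set p" "\<And>y. y \<in> set p \<Longrightarrow> gdist G v x \<le> gdist G y x"
    using arg_min_if_finite(1)[of "set p" "\<lambda>y. gdist G y x"]
      arg_min_least[of "set p" _ "\<lambda>y. gdist G y x"] pne by auto
  have "v \<rightarrow>\<^sup>*\<^bsub>G\<^esub> x" using v pv x by (intro undirected_tree_reachable[OF tree]) auto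
  then obtain r where r: "vpath r G" "hd r = v" "last r = x" "length r = Suc (gdist G v x)"
    by (rule ex_shortest_vpath)
  obtain r' where r': "r = v # r'" using r(1,2) by (cases r) auto
  have r'ne: "r' \<noteq> []" using r' r(3) v(1) x(2) by auto
  have disj: "y \<notin> set r'" if "y \<in> set p" for y
  proof
    assume "y \<in> set r'"
    then obtain r1 r2 where r12: "r' = r1 @ y # r2" by (meson split_list)
    have "vwalk ((v # r1) @ (y # r2)) G" using r(1) r' r12 by auto
    then have "vwalk (y # r2) G"
      by (rule vwalkI_append_r[rotated]) simp
    from gdist_le_vwalk[OF this] have "gdist G y x \<le> length r2"
      using r(3) r' r12 by simp
    moreover have "length r2 < gdist G v x" using r(4) r' r12 by simp
    ultimately show False using v(2)[OF that] by simp
  qed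
  \<comment> \<open>Appending \<open>r'\<close> to \<open>s\<close> gives a path to \<open>x\<close>
    longer by \<open>length r'\<close>. The general \<open>s\<close> serves twice: as the initial
    segment of \<open>p\<close> up to \<open>v\<close> and as the reversed final segment.\<close>
  have closer: "gdist G (hd s) v < gdist G (hd s) x"
    if s: "vpath s G" "last s = v" "set s \<subseteq> set p" for s
  proof -
    have sne: "s \<noteq> []" using s by auto
    have "vwalk (s \<oplus> r) G" using s r by (intro vwalk_joinI_vwalk') auto
    then have "vpath (s @ r') G"
      using s r r' disj by (auto simp: vwalk_join_def vpath_def)
    from undirected_tree_gdist_vpath[OF tree this]
    have "gdist G (hd s) x = length s + length r' - 1" using r r' r'ne sne by simp
    moreover have "gdist G (hd s) v = length s - 1"
      using undirected_tree_gdist_vpath[OF tree s(1)] s(2) by simp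
    ultimately show ?thesis using sne r'ne by (cases s; cases r') auto
  qed
  obtain p1 p2 where p12: "p = p1 @ v # p2" using v(1) by (meson split_list)
  have "vpath (take (Suc (length p1)) p) G" using p by (rule vpath_take) simp
  then have "vpath (p1 @ [v]) G" using p12 by simp
  then have "gdist G (hd (p1 @ [v])) v < gdist G (hd (p1 @ [v])) x"
    by (rule closer) (use p12 in auto)
  then have 1: "gdist G (hd p) v < gdist G (hd p) x"
    using p12 by (simp add: hd_append split: if_splits)
  have "vpath (take (Suc (length p2)) (rev p)) G" using vpath_rev[OF p] by (rule vpath_take) simp
  then have "vpath (rev p2 @ [v]) G" using p12 by simp
  then have "gdist G (hd (rev p2 @ [v])) v < gdist G (hd (rev p2 @ [v])) x"
    by (rule closer) (use p12 in auto)
  then have 2: "gdist G (last p) v < gdist G (last p) x"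
    using p12 by (simp add: hd_append hd_rev split: if_splits)
  from v(1) 1 2 show thesis by (rule that)
qed

section \<open>Labels along a path between two consistent vertices\<close>

lemma consistentD:
  assumes "consistent G c u" "v \<in> verts G" "w \<in> verts G" "gdist G u v < gdist G u w"
  shows "\<bar>c u - c v\<bar> \<le> \<bar>c u - c w\<bar>"
  using assms by (simp add: consistent_def label_dist_def)

text \<open>Bijectivity of the labeling enters as \<open>inj\<close> and \<open>onto\<close>: both
  survive passing to \<open>rev p\<close> and the labels \<open>- c\<close>, which do not range over
  1 to n.\<close>

context
  fixes G :: "('a, 'b) pre_digraph" and c :: "'a \<Rightarrow> int" and p :: "'a list"
  assumes tree: "undirected_tree G"
    and path: "vpath p G"
    and inj: "inj_on c (verts G)"
    and cons_hd: "consistent G c (hd p)"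
    and cons_last: "consistent G c (last p)"
    and ends: "c (hd p) < c (last p)"
    and onto: "{c (hd p)..c (last p)} \<subseteq> c ` verts G"
begin

lemma path_verts: "set p \<subseteq> verts G" and path_not_Nil: "p \<noteq> []"
  and path_distinct: "distinct p"
  using path by auto

lemma hd_in: "hd p \<in> verts G" and last_in: "last p \<in> verts G"
  using path_verts path_not_Nil by auto

text \<open>An inner vertex is nearer to each end than the other end is. Consistency of
  \<open>hd p\<close> thus bounds its label above by \<open>c (last p)\<close>, that of
  \<open>last p\<close> bounds it below by \<open>c (hd p)\<close>.\<close>

lemma label_on_path:
  assumes "v \<in> set p"
  shows "c v \<in> {c (hd p)..c (last p)}"
proof -
  let ?m = "length p"
  obtain i where i: "i < ?m" "v = p ! i" using assms by (auto simp: in_set_conv_nth)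
  have v: "v \<in> verts G" using assms path_verts by auto
  have last: "p ! (?m - 1) = last p" and hd: "p ! 0 = hd p"
    using path_not_Nil by (simp_all add: last_conv_nth hd_conv_nth)
  consider "v = hd p" | "v = last p" | "0 < i" "i < ?m - 1"
    using i last hd by (metis Suc_pred' bot_nat_0.not_eq_extremum less_Suc_eq less_nat_zero_code)
  then show ?thesis
  proof cases
    case 3
    have "gdist G (hd p) v < gdist G (hd p) (last p)"
      using undirected_tree_gdist_nth[OF tree path i(1)]
        undirected_tree_gdist_vpath[OF tree path] 3 i by simp
    then have "\<bar>c (hd p) - c v\<bar> \<le> c (last p) - c (hd p)"
      using consistentD[OF cons_hd v last_in] ends by simp
    moreover have "gdist G (last p) v < gdist G (last p) (hd p)"
      using undirected_tree_gdist_nth_last[OF tree path i(1)]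
        undirected_tree_gdist_nth_last[OF tree path, of 0] 3 i hd path_not_Nil
      by (simp add: diff_less_mono2)
    then have "\<bar>c (last p) - c v\<bar> \<le> c (last p) - c (hd p)"
      using consistentD[OF cons_last v hd_in] ends by simp
    ultimately show ?thesis by auto
  qed (use ends in auto)
qed

lemma label_between_imp_on_path:
  assumes x: "x \<in> verts G" and cx: "c x \<in> {c (hd p)..c (last p)}"
  shows "x \<in> set p"
proof (rule ccontr)
  assume "x \<notin> set p"
  then obtain v where v: "v \<in> set p"
    "gdist G (hd p) v < gdist G (hd p) x" "gdist G (last p) v < gdist G (last p) x"
    using undirected_tree_gate[OF tree path x] by blast
  have vv: "v \<in> verts G" using v path_verts by auto
  have "\<bar>c (hd p) - c v\<bar> \<le> \<bar>c (hd p) - c x\<bar>" "\<bar>c (last p) - c v\<bar> \<le> \<bar>c (last p) - c x\<bar>"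
    using consistentD[OF cons_hd vv x v(2)] consistentD[OF cons_last vv x v(3)] .
  then have "c v = c x" using cx label_on_path[OF v(1)] by auto
  then have "v = x" using inj vv x by (auto dest: inj_onD)
  then show False using v by simp
qed

lemma label_image_path: "c ` set p = {c (hd p)..c (last p)}"
proof
  show "c ` set p \<subseteq> {c (hd p)..c (last p)}" using label_on_path by blast
  show "{c (hd p)..c (last p)} \<subseteq> c ` set p"
    using onto label_between_imp_on_path by fastforce
qed

text \<open>Counting: the path has as many vertices as the interval of its labels has
  elements.\<close>

lemma label_range_length: "c (last p) - c (hd p) = int (length p) - 1"
proof -
  have "card (c ` set p) = length p"
    using inj_on_subset[OF inj path_verts] path_distinct by (simp add: card_image distinct_card)
  then have "nat (c (last p) - c (hd p) + 1) = length p"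
    unfolding label_image_path by (simp add: algebra_simps)
  then show ?thesis using ends by simp
qed

text \<open>Consistency of \<open>hd p\<close> gives the weak inequality, injectivity makes it
  strict.\<close>

lemma label_step:
  assumes "Suc i < length p"
  shows "c (p ! i) < c (p ! Suc i)"
proof -
  have in_p: "p ! i \<in> set p" "p ! Suc i \<in> set p" using assms by auto
  have v: "p ! i \<in> verts G" "p ! Suc i \<in> verts G" using in_p path_verts by auto
  have "gdist G (hd p) (p ! i) < gdist G (hd p) (p ! Suc i)"
    using assms by (simp add: undirected_tree_gdist_nth[OF tree path])
  then have "\<bar>c (hd p) - c (p ! i)\<bar> \<le> \<bar>c (hd p) - c (p ! Suc i)\<bar>"
    using consistentD[OF cons_hd v] by simp
  then have "c (p ! i) \<le> c (p ! Suc i)" using in_p[THEN label_on_path] by auto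
  moreover have "p ! i \<noteq> p ! Suc i"
    using path_distinct assms nth_eq_iff_index_eq[of p i "Suc i"] by auto
  then have "c (p ! i) \<noteq> c (p ! Suc i)" using inj v by (auto dest: inj_onD)
  ultimately show ?thesis by simp
qed

text \<open>Each of the \<open>length p - 1\<close> steps raises the label by at least 1, and the
  total rise is \<open>length p - 1\<close>, so each step raises it by exactly 1.\<close>

lemma label_nth:
  assumes "i < length p"
  shows "c (p ! i) = c (hd p) + int i"
proof (rule antisym)
  show "c (hd p) + int i \<le> c (p ! i)"
    using assms
  proof (induct i)
    case 0
    then show ?case by (simp add: hd_conv_nth)
  next
    case (Suc i)
    then show ?case using label_step[of i] by simp
  qed
  have "i \<le> length p - 1" using assms by simp
  \<comment> \<open>Downward induction from the last vertex gives the upper bound.\<close>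
  then have "c (p ! i) \<le> c (last p) - int (length p - Suc i)"
  proof (induct rule: inc_induct)
    case base
    then show ?case using path_not_Nil by (simp add: last_conv_nth)
  next
    case (step n)
    then have "c (p ! n) < c (p ! Suc n)" by (intro label_step) simp
    then show ?case using step by (simp add: of_nat_diff)
  qed
  then show "c (p ! i) \<le> c (hd p) + int i"
    using label_range_length assms by (simp add: of_nat_diff)
qed

section \<open>Balls about the ends of the path\<close>

lemma closed_nbhd_hd_subset:
  assumes t: "t + 2 \<le> length p"
  shows "closed_nbhd G t (hd p) \<subseteq>
    set (take (Suc t) p) \<union> label_preimage G c {c (hd p) - int t - 1..c (hd p) - 1}"
proof
  fix x assume "x \<in> closed_nbhd G t (hd p)"
  then have x: "x \<in> verts G" "gdist G (hd p) x \<le> t" by (auto simp: closed_nbhd_def)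
  \<comment> \<open>The first path vertex outside the ball; \<open>t + 2 \<le> length p\<close>
    guarantees that it exists.\<close>
  define w where "w = p ! Suc t"
  have w: "w \<in> verts G" "gdist G (hd p) w = Suc t" "c w = c (hd p) + int (Suc t)"
    using t path_verts undirected_tree_gdist_nth[OF tree path, of "Suc t"] label_nth[of "Suc t"]
    by (auto simp: w_def)
  have "\<bar>c (hd p) - c x\<bar> \<le> \<bar>c (hd p) - c w\<bar>"
    using consistentD[OF cons_hd x(1) w(1)] x(2) w(2) by simp
  then have cx: "\<bar>c (hd p) - c x\<bar> \<le> int t + 1" using w(3) by simp
  show "x \<in> set (take (Suc t) p) \<union> label_preimage G c {c (hd p) - int t - 1..c (hd p) - 1}"
  proof (cases "c x < c (hd p)")
    case True
    then show ?thesis using cx x by (auto simp: label_preimage_def)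
  next
    case False
    \<comment> \<open>The label is at most \<open>c (hd p) + t + 1\<close>, which does not exceed
      \<open>c (last p)\<close> because the path has at least \<open>t + 2\<close> vertices.\<close>
    then have "c x \<in> {c (hd p)..c (last p)}" using cx t label_range_length by auto
    then have "x \<in> set p" using x label_between_imp_on_path by blast
    then obtain i where i: "i < length p" "x = p ! i" by (auto simp: in_set_conv_nth)
    then have "i \<le> t" using x undirected_tree_gdist_nth[OF tree path] by simp
    then have "x \<in> set (take (Suc t) p)" using i by (auto simp: in_set_conv_nth)
    then show ?thesis by simp
  qed
qed

text \<open>The path segment and the label interval contribute at most \<open>t + 1\<close> vertices
  each.\<close>

lemma card_closed_nbhd_hd:
  assumes t: "t + 2 \<le> length p"
  shows "card (closed_nbhd G t (hd p)) \<le> 2 * t + 2"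
proof -
  let ?I = "{c (hd p) - int t - 1..c (hd p) - 1}"
  have inj': "inj_on c (label_preimage G c ?I)"
    using inj by (rule inj_on_subset) (auto simp: label_preimage_def)
  have sub: "c ` label_preimage G c ?I \<subseteq> ?I" by (auto simp: label_preimage_def)
  have fin: "finite (label_preimage G c ?I)"
    using finite_subset[OF sub] finite_imageD[OF _ inj'] by simp
  have "card (label_preimage G c ?I) \<le> card ?I"
    using inj' sub by (intro card_inj_on_le) auto
  moreover have "card (set (take (Suc t) p)) \<le> Suc t"
    using card_length[of "take (Suc t) p"] by simp
  moreover have "card (closed_nbhd G t (hd p)) \<le>
      card (set (take (Suc t) p) \<union> label_preimage G c ?I)"
    using closed_nbhd_hd_subset[OF t] fin by (intro card_mono) auto
  ultimately show ?thesis
    using card_Un_le[of "set (take (Suc t) p)" "label_preimage G c ?I"] by simp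
qed

end

theorem corollary3p5:
  fixes T :: "('a, 'b) pre_digraph"
    and c :: "'a \<Rightarrow> int"
    and S :: "'a set"
    and a b :: 'a
    and p :: "'a list"
    and m t :: nat
  assumes "undirected_tree T"
    and "labeling T c"
    and "S = consistent_verts T c"
    and "2 \<le> card S"
    and "a \<in> S" and "c a = Min (c ` S)"
    and "b \<in> S" and "c b = Max (c ` S)"
    and "vpath p T" and "hd p = a" and "last p = b"
    and "m = length p"
    and "1 \<le> t" and "int t \<le> int m - 2"
  shows "closed_nbhd T t a \<subseteq>
           {p ! (i - 1) | i. i \<in> {1..t + 1}} \<union>
           label_preimage T c {c a - int t - 1..c a - 1} \<and>
         card (closed_nbhd T t a) \<le> 2 * t + 2 \<and>
         closed_nbhd T t b \<subseteq>
           {p ! (i - 1) | i. i \<in> {m - t..m}} \<union>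
           label_preimage T c {c b + 1..c b + int t + 1} \<and>
         card (closed_nbhd T t b) \<le> 2 * t + 2"
proof -
  interpret graph T using assms(1) by (rule undirected_tree_graph)
  have S: "S \<subseteq> verts T" using assms(3) by (auto simp: consistent_verts_def)
  have cons: "consistent T c a" "consistent T c b"
    using assms(3,5,7) by (auto simp: consistent_verts_def)
  have ab: "a \<in> verts T" "b \<in> verts T" using assms(5,7) S by auto
  have len: "t + 2 \<le> length p" using assms(12,14) by simp
  have inj: "inj_on c (verts T)" and img: "c ` verts T = {1..int (card (verts T))}"
    using assms(2) by (auto simp: labeling_def bij_betw_def)
  have pne: "p \<noteq> []" using len by auto
  have "a \<noteq> b"
  proof
    \<comment> \<open>The path has at least two vertices, so its ends are at positive
      distance.\<close>
    assume "a = b"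
    then have "length p - 1 = gdist T a a"
      using undirected_tree_gdist_vpath[OF assms(1,9)] assms(10,11) by simp
    also have "\<dots> = 0" using gdist_le_vwalk[of "[a]"] ab by simp
    finally show False using len by simp
  qed
  moreover have "c a \<le> c b"
  proof -
    have "finite (c ` S)" using finite_subset[OF S] by simp
    then have "Min (c ` S) \<le> c b" using assms(7) by (intro Min_le) auto
    then show ?thesis using assms(6) by simp
  qed
  ultimately have lt: "c a < c b" using inj_onD[OF inj, of a b] ab by fastforce
  have "c a \<in> {1..int (card (verts T))}" "c b \<in> {1..int (card (verts T))}"
    using ab unfolding img[symmetric] by auto
  \<comment> \<open>Every integer between two labels is itself a label, since the labels fill an
    interval.\<close>
  then have onto: "{c a..c b} \<subseteq> c ` verts T" unfolding img by auto
  have neg_onto: "{- c b..- c a} \<subseteq> (\<lambda>x. - c x) ` verts T"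
  proof
    fix k assume "k \<in> {- c b..- c a}"
    then have "- k \<in> {c a..c b}" by auto
    then obtain x where "x \<in> verts T" "- k = c x" using onto by blast
    then show "k \<in> (\<lambda>x. - c x) ` verts T" by (intro image_eqI[of _ _ x]) auto
  qed
  have neg_cons: "consistent T (\<lambda>x. - c x) a" "consistent T (\<lambda>x. - c x) b"
    using cons by (simp_all add: consistent_def label_dist_def abs_minus_commute)
  have neg_inj: "inj_on (\<lambda>x. - c x) (verts T)" using inj by (auto simp: inj_on_def)
  \<comment> \<open>Negation carries the interval below \<open>- c b\<close> to the one above
    \<open>c b\<close>.\<close>
  have neg_pre: "label_preimage T (\<lambda>x. - c x) {- c b - int t - 1..- c b - 1}
      = label_preimage T c {c b + 1..c b + int t + 1}"
    by (auto simp: label_preimage_def)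
  have ra: "vpath (rev p) T" "hd (rev p) = b" "last (rev p) = a"
    using assms(9-11) vpath_rev pne by (auto simp: hd_rev last_rev)
  have A: "closed_nbhd T t a \<subseteq>
      set (take (Suc t) p) \<union> label_preimage T c {c a - int t - 1..c a - 1}"
    "card (closed_nbhd T t a) \<le> 2 * t + 2"
    using closed_nbhd_hd_subset[of T p c t] card_closed_nbhd_hd[of T p c t]
      assms(1,9-11) inj cons lt onto len by auto
  have B: "closed_nbhd T t b \<subseteq>
      set (take (Suc t) (rev p)) \<union> label_preimage T c {c b + 1..c b + int t + 1}"
    "card (closed_nbhd T t b) \<le> 2 * t + 2"
    using closed_nbhd_hd_subset[of T "rev p" "\<lambda>x. - c x" t]
      card_closed_nbhd_hd[of T "rev p" "\<lambda>x. - c x" t]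
      assms(1) ra neg_inj neg_cons lt neg_onto neg_pre len by auto
  have "set (take (Suc t) p) \<subseteq> {p ! (i - 1) | i. i \<in> {1..t + 1}}"
  proof
    fix x assume "x \<in> set (take (Suc t) p)"
    then obtain j where "j < Suc t" "x = p ! j" by (auto simp: in_set_conv_nth)
    then show "x \<in> {p ! (i - 1) | i. i \<in> {1..t + 1}}"
      by (intro CollectI exI[of _ "Suc j"]) auto
  qed
  moreover have "set (take (Suc t) (rev p)) \<subseteq> {p ! (i - 1) | i. i \<in> {m - t..m}}"
  proof
    fix x assume "x \<in> set (take (Suc t) (rev p))"
    then obtain j where "j < Suc t" "j < length p" "x = p ! (length p - Suc j)"
      by (auto simp: in_set_conv_nth rev_nth)
    then show "x \<in> {p ! (i - 1) | i. i \<in> {m - t..m}}"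
      \<comment> \<open>Counting \<open>j\<close> steps back from the end reaches the vertex with
        1-based index \<open>m - j\<close>.\<close>
      using assms(12) by (intro CollectI exI[of _ "m - j"]) auto
  qed
  ultimately show ?thesis using A B by blast
qed

end
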